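(* Let $q$ be a prime power, $n,r$ positive integers, and let $U_1,\ldots,U_r$ be $\mathbb{F}_q$-subspaces of $\mathbb{F}_{q^n}$ with $k_i=\dim_{\mathbb{F}_q}(U_i)\geq 2$ for every $i\in\{1,\ldots,r\}$. Let $\mathbf{e}_i\in\mathbb{F}_{q^n}^r$ denote the vector whose $i$-th entry is $1$ and all other entries are $0$. Then the following are equivalent: (i) the $\mathbb{F}_q$-subspace $U=U_1\times\cdots\times U_r$ of $\mathbb{F}_{q^n}^r$ satisfies (a) $\dim_{\mathbb{F}_q}(U\cap\langle\mathbf{v}\rangle_{\mathbb{F}_{q^n}})\leq 1$ for every $\mathbf{v}\in\mathbb{F}_{q^n}^r$ with $\langle\mathbf{v}\rangle_{\mathbb{F}_{q^n}}\notin\{\langle\mathbf{e}_i\rangle_{\mathbb{F}_{q^n}}: i\in\{1,\ldots,r\}\}$, and (b) $\dim_{\mathbb{F}_q}(U\cap\langle\mathbf{e}_i\rangle_{\mathbb{F}_{q^n}})=k_i\geq 2$ for every $i\in\{1,\ldots,r\}$; (ii) $U_i\cdot U_i^{-1}\cap U_j\cdot U_j^{-1}=\mathbb{F}_q$ for all $i\neq j$; (iii) $\dim_{\mathbb{F}_q}(U_i\cap\alpha U_j)\leq 1$ for every $\alpha\in\mathbb{F}_{q^n}$ and all $i,j\in\{1,\ldots,r\}$ with $i\neq j$.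
   Context: For $\mathbb{F}_q$-subspaces $U,V$ of $\mathbb{F}_{q^n}$: $U^{-1}=\{u^{-1}: u\in U\setminus\{0\}\}$, $U\cdot V=\{uv: u\in U, v\in V\}$, and $\alpha U=\{\alpha u: u\in U\}$. $\langle \mathbf{v}\rangle_{\mathbb{F}_{q^n}}$ is the $\mathbb{F}_{q^n}$-span of $\mathbf{v}$. *)

theory Defs
  imports
    "HOL-Analysis.Cartesian_Space"
    "HOL-Library.Set_Algebras"
    "HOL-Number_Theory.Prime_Powers"
begin

(* The extension of fields F_q <= F_(q^n) is an embedding emb of a field of scalars 'k into a field
   'a. The F_q-structures on 'a and on 'a^'r are obtained by restricting scalars along emb, so that
   the library's notions of subspace and dimension apply; F_q as a subset of 'a is range emb. *)

locale field_embedding =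
  fixes emb :: "'k::field \<Rightarrow> 'a::field"
  assumes emb_one: "emb 1 = 1"
    and emb_add: "emb (x + y) = emb x + emb y"
    and emb_mult: "emb (x * y) = emb x * emb y"

definition scale_elt :: "('k \<Rightarrow> 'a::field) \<Rightarrow> 'k \<Rightarrow> 'a \<Rightarrow> 'a"
  where "scale_elt emb c x = emb c * x"

definition scale_vec :: "('k \<Rightarrow> 'a::field) \<Rightarrow> 'k \<Rightarrow> 'a ^ 'r \<Rightarrow> 'a ^ 'r"
  where "scale_vec emb c v = emb c *s v"

context field_embedding
begin

lemma vector_space_scale_elt: "vector_space (scale_elt emb)"
  by unfold_locales (simp_all add: scale_elt_def emb_one emb_add emb_mult algebra_simps)

lemma vector_space_scale_vec: "vector_space (scale_vec emb :: 'k \<Rightarrow> 'a ^ 'r \<Rightarrow> 'a ^ 'r)"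
  by unfold_locales (simp_all add: scale_vec_def emb_one emb_add emb_mult vec_eq_iff algebra_simps)

end

abbreviation subspace_elt :: "('k::field \<Rightarrow> 'a::field) \<Rightarrow> 'a set \<Rightarrow> bool"
  where "subspace_elt emb \<equiv> module.subspace (scale_elt emb)"

abbreviation dim_elt :: "('k::field \<Rightarrow> 'a::field) \<Rightarrow> 'a set \<Rightarrow> nat"
  where "dim_elt emb \<equiv> vector_space.dim (scale_elt emb)"

abbreviation dim_vec :: "('k::field \<Rightarrow> 'a::field) \<Rightarrow> ('a ^ 'r) set \<Rightarrow> nat"
  where "dim_vec emb \<equiv> vector_space.dim (scale_vec emb)"

definition set_inverse :: "'a::field set \<Rightarrow> 'a set"
  where "set_inverse U = {inverse u | u. u \<in> U - {0}}"

definition set_product :: "('r \<Rightarrow> 'a set) \<Rightarrow> ('a ^ 'r) set"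
  where "set_product U = {v. \<forall>i. v $ i \<in> U i}"

lemma (in field_embedding) subspace_set_product:
  assumes "\<And>i. subspace_elt emb (U i)"
  shows "module.subspace (scale_vec emb) (set_product U)"
proof -
  interpret elt: vector_space "scale_elt emb" by (rule vector_space_scale_elt)
  interpret vs: vector_space "scale_vec emb :: 'k \<Rightarrow> 'a ^ 'b \<Rightarrow> 'a ^ 'b"
    by (rule vector_space_scale_vec)
  show ?thesis
    using assms
    unfolding vs.subspace_def elt.subspace_def
    by (auto simp: set_product_def scale_elt_def scale_vec_def)
qed

end

theory Submission
  imports Defs
begin

text \<open>
  The quotients \<open>a / b\<close> of elements of \<open>U i\<close> that are also quotients \<open>c / d\<close> of elements of
  \<open>U j\<close> correspond to the pairs \<open>(b, a)\<close> in \<open>U i \<inter> \<alpha> U j\<close> with \<open>\<alpha> = b / d\<close>, and such a pair is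
  proportional over \<open>F_q\<close> exactly when \<open>a / b\<close> lies in \<open>F_q\<close>. The points of the product on a line
  spanned by a vector \<open>v\<close> with two nonzero coordinates \<open>v_i\<close>, \<open>v_j\<close> embed into
  \<open>U i \<inter> (v_i / v_j) U j\<close>, with equality (up to scaling) for \<open>v = \<alpha> e_i + e_j\<close>.
\<close>

section \<open>Dimension at most one, and dimension under injective linear maps\<close>

text \<open>A basis chosen inside \<open>S\<close> has at most one element precisely when all of
  \<open>S\<close> lies on one line. Finiteness rules out an infinite basis, whose
  \<open>card\<close> would be 0.\<close>

lemma (in vector_space) dim_le_1_iff:
  assumes "finite S"
  shows "dim S \<le> 1 \<longleftrightarrow> (\<forall>x\<in>S. \<forall>y\<in>S. x \<noteq> 0 \<longrightarrow> (\<exists>c. y = scale c x))"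
proof
  assume le: "dim S \<le> 1"
  obtain B where B: "B \<subseteq> S" "S \<subseteq> span B" "card B = dim S"
    using basis_exists[of S] by metis
  have "finite B"
    using B(1) assms by (rule finite_subset)
  with B(3) le have "B = {} \<or> (\<exists>b. B = {b})"
    by (metis card_1_singletonE card_0_eq le_less less_one)
  \<comment> \<open>If the basis is empty, any \<open>b\<close> serves: only the inclusion in
    \<open>{b}\<close> matters below.\<close>
  then obtain b where b: "B \<subseteq> {b}"
    by auto
  show "\<forall>x\<in>S. \<forall>y\<in>S. x \<noteq> 0 \<longrightarrow> (\<exists>c. y = scale c x)"
  proof (intro ballI impI)
    fix x y assume "x \<in> S" "y \<in> S" "x \<noteq> 0"
    moreover have "S \<subseteq> span {b}"
      using B(2) span_mono[OF b] by blast
    ultimately obtain s t where "x = scale s b" "y = scale t b"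
      unfolding span_singleton by blast
    with \<open>x \<noteq> 0\<close> have "y = scale (t / s) x"
      by auto
    then show "\<exists>c. y = scale c x" ..
  qed
next
  assume *: "\<forall>x\<in>S. \<forall>y\<in>S. x \<noteq> 0 \<longrightarrow> (\<exists>c. y = scale c x)"
  show "dim S \<le> 1"
  proof (cases "S \<subseteq> {0}")
    case True
    then have "dim S \<le> card ({} :: 'b set)"
      by (intro dim_le_card) auto
    then show ?thesis
      by simp
  next
    case False
    then obtain x where "x \<in> S" "x \<noteq> 0"
      by auto
    with * have "S \<subseteq> span {x}"
      unfolding span_singleton by blast
    then have "dim S \<le> card {x}"
      by (intro dim_le_card) auto
    then show ?thesis
      by simp
  qed
qed

text \<open>An injective linear map carries a basis of \<open>S\<close> to an independent set of the
  same size that spans the image. This later moves dimensions from the field to a coordinate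
  axis.\<close>

lemma (in Vector_Spaces.linear) dim_image_eq_inj:
  assumes "inj f"
  shows "vs2.dim (f ` S) = vs1.dim S"
proof -
  obtain B where B: "B \<subseteq> S" "vs1.independent B" "S \<subseteq> vs1.span B" "card B = vs1.dim S"
    using vs1.basis_exists[of S] by metis
  have "vs2.dim (f ` S) = card (f ` B)"
  proof (rule vs2.dim_unique[OF _ _ _ refl])
    show "f ` B \<subseteq> f ` S"
      using B(1) by blast
    show "f ` S \<subseteq> vs2.span (f ` B)"
      using B(3) by (auto simp: span_image)
    show "vs2.independent (f ` B)"
      using B(2) assms by (intro independent_injective_image) (auto intro: inj_on_subset)
  qed
  also have "\<dots> = card B"
    using assms by (intro card_image) (auto intro: inj_on_subset)
  finally show ?thesis
    using B(4) by simp
qed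

section \<open>Lines in the coordinate space that are or are not axes\<close>

lemma span_axis_eqI:
  fixes v :: "'a::field ^ 'r::finite"
  assumes "v $ i \<noteq> 0" and "\<And>j. j \<noteq> i \<Longrightarrow> v $ j = 0"
  shows "vec.span {v} = vec.span {axis i 1}"
proof -
  have "v = v $ i *s axis i 1"
    using assms by (auto simp: vec_eq_iff axis_def)
  then have "vec.span {v} = vec.span {v $ i *s axis i 1}"
    by simp
  also have "\<dots> = vec.span {axis i 1}"
    using assms(1) by (rule vec.span_image_scale[of "{axis i 1}" "\<lambda>_. v $ i", simplified])
  finally show ?thesis .
qed

lemma span_neq_span_axis:
  fixes v :: "'a::field ^ 'r::finite"
  assumes "v $ i \<noteq> 0" "v $ j \<noteq> 0" "i \<noteq> j"
  shows "vec.span {v} \<noteq> vec.span {axis l 1}"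
proof
  assume "vec.span {v} = vec.span {axis l 1}"
  then have "v \<in> vec.span {axis l 1}"
    by (metis vec.span_base singletonI)
  then obtain c where "v = c *s axis l 1"
    by (auto simp: vec.span_singleton)
  with assms show False
    by (auto simp: axis_def split: if_splits)
qed

section \<open>Quotient sets and scaled intersections\<close>

context field_embedding
begin

text \<open>Any scalar c is (c u) / u for a fixed nonzero u, so in condition (ii) only the inclusion
  into \<open>range emb\<close> has content.\<close>

lemma range_emb_subset_quotients:
  assumes "subspace_elt emb U" "u \<in> U" "u \<noteq> 0"
  shows "range emb \<subseteq> U * set_inverse U"
proof
  fix z assume "z \<in> range emb"
  then obtain c where c: "z = emb c"
    by auto
  interpret elt: vector_space "scale_elt emb"
    by (rule vector_space_scale_elt)
  have "emb c * u \<in> U"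
    using elt.subspace_scale[OF assms(1,2), of c] by (simp add: scale_elt_def)
  moreover have "inverse u \<in> set_inverse U"
    using assms by (auto simp: set_inverse_def)
  moreover have "z = (emb c * u) * inverse u"
    using assms c by simp
  ultimately show "z \<in> U * set_inverse U"
    by blast
qed

lemma dim_elt_le_1_iff:
  assumes "finite S"
  shows "dim_elt emb S \<le> 1 \<longleftrightarrow> (\<forall>x\<in>S. \<forall>y\<in>S. x \<noteq> 0 \<longrightarrow> (\<exists>c. y = emb c * x))"
  using vector_space.dim_le_1_iff[OF vector_space_scale_elt assms]
  by (simp add: scale_elt_def)

lemma dim_vec_le_1_iff:
  fixes S :: "('a ^ 'r) set"
  assumes "finite S"
  shows "dim_vec emb S \<le> 1 \<longleftrightarrow> (\<forall>x\<in>S. \<forall>y\<in>S. x \<noteq> 0 \<longrightarrow> (\<exists>c. y = emb c *s x))"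
  using vector_space.dim_le_1_iff[OF vector_space_scale_vec assms]
  by (simp add: scale_vec_def)

lemma quotients_Int_iff_dim_le_1:
  assumes "finite U" "subspace_elt emb U" "\<exists>u\<in>U. u \<noteq> 0"
    and "subspace_elt emb V" "\<exists>v\<in>V. v \<noteq> 0"
  shows "(U * set_inverse U) \<inter> (V * set_inverse V) = range emb \<longleftrightarrow>
    (\<forall>\<alpha>. dim_elt emb (U \<inter> (\<alpha> *o V)) \<le> 1)"
proof
  assume eq: "(U * set_inverse U) \<inter> (V * set_inverse V) = range emb"
  show "\<forall>\<alpha>. dim_elt emb (U \<inter> (\<alpha> *o V)) \<le> 1"
  proof
    fix \<alpha>
    have "\<exists>c. y = emb c * x"
      if x: "x \<in> U" "x \<in> \<alpha> *o V" "x \<noteq> 0" and y: "y \<in> U" "y \<in> \<alpha> *o V" for x y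
    proof -
      obtain x' y' where x': "x' \<in> V" "x = \<alpha> * x'" and y': "y' \<in> V" "y = \<alpha> * y'"
        using x y by (auto simp: elt_set_times_def)
      have "y * inverse x \<in> U * set_inverse U"
        using x y by (intro set_times_intro) (auto simp: set_inverse_def)
      moreover have "y' * inverse x' \<in> V * set_inverse V"
        using x x' y' by (intro set_times_intro) (auto simp: set_inverse_def)
      \<comment> \<open>The common factor \<alpha> cancels; it is nonzero because x = \<alpha> x' is
        nonzero.\<close>
      moreover have "y * inverse x = y' * inverse x'"
        using x x' y' by (simp add: field_simps)
      ultimately have "y * inverse x \<in> range emb"
        using eq by auto
      then obtain c where "y * inverse x = emb c"
        by auto
      then have "y = emb c * x"
        using x(3) by (simp add: field_simps)
      then show ?thesis ..
    qed
    then show "dim_elt emb (U \<inter> (\<alpha> *o V)) \<le> 1"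
      using assms(1) by (subst dim_elt_le_1_iff) auto
  qed
next
  assume dim: "\<forall>\<alpha>. dim_elt emb (U \<inter> (\<alpha> *o V)) \<le> 1"
  show "(U * set_inverse U) \<inter> (V * set_inverse V) = range emb"
  proof
    show "range emb \<subseteq> (U * set_inverse U) \<inter> (V * set_inverse V)"
      using assms range_emb_subset_quotients by blast
    show "(U * set_inverse U) \<inter> (V * set_inverse V) \<subseteq> range emb"
    proof
      fix z assume "z \<in> (U * set_inverse U) \<inter> (V * set_inverse V)"
      then obtain a b c d where ab: "a \<in> U" "b \<in> U" "b \<noteq> 0" "z = a * inverse b"
        and cd: "c \<in> V" "d \<in> V" "d \<noteq> 0" "z = c * inverse d"
        by (auto simp: set_times_def set_inverse_def)
      \<comment> \<open>This scaling takes d to b, and a / b = c / d forces it to take c to a as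
        well. Hence a and b meet in one intersection, where the dimension bound makes a an
        F_q-multiple of b.\<close>
      define \<alpha> where "\<alpha> = b / d"
      have "b = \<alpha> * d"
        using cd(3) by (simp add: \<alpha>_def)
      moreover have "a = \<alpha> * c"
        using ab cd by (simp add: \<alpha>_def field_simps)
      ultimately have "a \<in> U \<inter> (\<alpha> *o V)" "b \<in> U \<inter> (\<alpha> *o V)"
        using ab cd by (auto simp: elt_set_times_def)
      moreover have "finite (U \<inter> (\<alpha> *o V))"
        using assms(1) by simp
      ultimately obtain t where "a = emb t * b"
        using dim ab(3) dim_elt_le_1_iff by blast
      then show "z \<in> range emb"
        using ab by (simp add: mult.assoc)
    qed
  qed
qed

section \<open>Intersections of the product with lines\<close>

text \<open>Every factor contains 0, so the product meets the axis in a copy of \<open>U i\<close>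
  under the injective map \<open>axis i\<close>.\<close>

lemma dim_vec_set_product_Int_span_axis:
  fixes U :: "'r::finite \<Rightarrow> 'a set"
  assumes "\<And>i. subspace_elt emb (U i)"
  shows "dim_vec emb (set_product U \<inter> vec.span {axis i 1}) = dim_elt emb (U i)"
proof -
  interpret elt: vector_space "scale_elt emb"
    by (rule vector_space_scale_elt)
  interpret vs: vector_space "scale_vec emb :: 'k \<Rightarrow> 'a ^ 'r \<Rightarrow> 'a ^ 'r"
    by (rule vector_space_scale_vec)
  interpret ax: Vector_Spaces.linear "scale_elt emb" "scale_vec emb" "axis i :: 'a \<Rightarrow> 'a ^ 'r"
    by unfold_locales (auto simp: scale_elt_def scale_vec_def vec_eq_iff axis_def)
  have "0 \<in> U j" for j
    using assms elt.subspace_0 by blast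
  then have "axis i x \<in> set_product U \<longleftrightarrow> x \<in> U i" for x
    by (auto simp: set_product_def axis_def split: if_splits)
  moreover have "vec.span {axis i 1 :: 'a ^ 'r} = range (axis i)"
    by (auto simp: vec.span_singleton vec_eq_iff axis_def image_iff)
  ultimately have "set_product U \<inter> vec.span {axis i 1} = axis i ` U i"
    by auto
  moreover have "inj (axis i :: 'a \<Rightarrow> 'a ^ 'r)"
    by (auto simp: inj_def axis_eq_axis)
  ultimately show ?thesis
    using ax.dim_image_eq_inj by simp
qed

lemma dim_off_axes_le_1_iff:
  fixes U :: "'r::finite \<Rightarrow> 'a set"
  assumes "\<And>i. finite (U i)" and sub: "\<And>i. subspace_elt emb (U i)"
  shows "(\<forall>v :: 'a ^ 'r. vec.span {v} \<notin> {vec.span {axis i 1} | i. True} \<longrightarrow>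
        dim_vec emb (set_product U \<inter> vec.span {v}) \<le> 1) \<longleftrightarrow>
    (\<forall>\<alpha> i j. i \<noteq> j \<longrightarrow> dim_elt emb (U i \<inter> (\<alpha> *o U j)) \<le> 1)"
    (is "?lines \<longleftrightarrow> ?pairs")
proof -
  interpret elt: vector_space "scale_elt emb"
    by (rule vector_space_scale_elt)
  have zero: "0 \<in> U j" for j
    using sub elt.subspace_0 by blast
  \<comment> \<open>Vectors correspond to their coordinate functions, which range over a finite
    product of finite sets. The proportionality criterion requires this finiteness.\<close>
  have "finite (set_product U)"
  proof (rule finite_subset)
    show "set_product U \<subseteq> vec_lambda ` (Pi\<^sub>E UNIV U)"
    proof
      fix v assume "v \<in> set_product U"
      then have "($) v \<in> Pi\<^sub>E UNIV U"
        by (auto simp: set_product_def)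
      then show "v \<in> vec_lambda ` (Pi\<^sub>E UNIV U)"
        by (metis image_eqI vec_nth_inverse)
    qed
    show "finite (vec_lambda ` (Pi\<^sub>E UNIV U) :: ('a ^ 'r) set)"
      using assms(1) by (intro finite_imageI finite_PiE) auto
  qed
  then have fin: "finite (set_product U \<inter> S)" for S
    by simp
  show ?thesis
  proof
    assume lines: ?lines
    show ?pairs
    proof (intro allI impI)
      fix \<alpha> and i j :: 'r
      assume "i \<noteq> j"
      have "\<exists>c. y = emb c * x"
        if x: "x \<in> U i" "x \<in> \<alpha> *o U j" "x \<noteq> 0" and y: "y \<in> U i" "y \<in> \<alpha> *o U j" for x y
      proof -
        obtain x' y' where x': "x' \<in> U j" "x = \<alpha> * x'" and y': "y' \<in> U j" "y = \<alpha> * y'"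
          using x y by (auto simp: elt_set_times_def)
        \<comment> \<open>The multiple s v lies in the product exactly when s is in
          \<open>U j\<close> and \<alpha> s is in \<open>U i\<close>, so x' and y' parametrize two
          points of the product on this line.\<close>
        define v :: "'a ^ 'r" where "v = axis i \<alpha> + axis j 1"
        have v: "v $ i = \<alpha>" "v $ j = 1" "\<And>l. l \<noteq> i \<Longrightarrow> l \<noteq> j \<Longrightarrow> v $ l = 0"
          using \<open>i \<noteq> j\<close> by (auto simp: v_def axis_def)
        \<comment> \<open>Here \<alpha> is nonzero because x = \<alpha> x' is, so v has two nonzero
          coordinates. For \<alpha> = 0 there is no such x and nothing to prove.\<close>
        have "vec.span {v} \<noteq> vec.span {axis l 1}" for l
          using v x x' \<open>i \<noteq> j\<close> by (intro span_neq_span_axis[of _ i j]) auto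
        with lines have dim: "dim_vec emb (set_product U \<inter> vec.span {v}) \<le> 1"
          by blast
        have mem: "s *s v \<in> set_product U \<inter> vec.span {v}" if "s \<in> U j" "\<alpha> * s \<in> U i" for s
        proof -
          have "s * v $ l \<in> U l" for l
            using that v zero by (cases "l = i"; cases "l = j") (auto simp: mult.commute)
          then show ?thesis
            by (auto simp: set_product_def vec.span_singleton)
        qed
        have "(x' *s v) $ j \<noteq> 0"
          using v x x' by simp
        then have "x' *s v \<noteq> 0"
          by (metis zero_index)
        then obtain c where "y' *s v = emb c *s (x' *s v)"
          using dim mem x y x' y' dim_vec_le_1_iff[OF fin] by blast
        \<comment> \<open>The j-th coordinate of v is 1, so this reads y' = c x' with c in F_q;
          multiplying by \<alpha> gives the claim for y and x.\<close>
        then have "(y' *s v) $ j = (emb c *s (x' *s v)) $ j"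
          by (simp only:)
        then have "y = emb c * x"
          using v x' y' by simp
        then show ?thesis ..
      qed
      then show "dim_elt emb (U i \<inter> (\<alpha> *o U j)) \<le> 1"
        using assms(1) by (subst dim_elt_le_1_iff) auto
    qed
  next
    assume pairs: ?pairs
    show ?lines
    proof (intro allI impI)
      fix v :: "'a ^ 'r"
      assume v: "vec.span {v} \<notin> {vec.span {axis i 1} | i. True}"
      have "\<exists>c. y = emb c *s x"
        if x: "x \<in> set_product U" "x \<in> vec.span {v}" "x \<noteq> 0"
          and y: "y \<in> set_product U" "y \<in> vec.span {v}" for x y
      proof -
        obtain s t where s: "x = s *s v" and t: "y = t *s v"
          using x y by (auto simp: vec.span_singleton)
        obtain i where i: "v $ i \<noteq> 0"
          using x s by (auto simp: vec_eq_iff)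
        \<comment> \<open>A vector with only one nonzero coordinate would span an axis.\<close>
        with v obtain j where j: "j \<noteq> i" "v $ j \<noteq> 0"
          using span_axis_eqI by blast
        \<comment> \<open>This ratio takes the j-th coordinate to the i-th simultaneously for all
          multiples of v.\<close>
        define \<alpha> where "\<alpha> = v $ i / v $ j"
        have mem: "w * v $ i \<in> U i \<inter> (\<alpha> *o U j)" if "w *s v \<in> set_product U" for w
        proof -
          have "w * v $ i = \<alpha> * (w * v $ j)"
            using j by (simp add: \<alpha>_def)
          moreover have "w * v $ l \<in> U l" for l
            using that by (simp add: set_product_def)
          ultimately show ?thesis
            unfolding elt_set_times_def by blast
        qed
        have "s * v $ i \<noteq> 0"
          using i s x by auto
        moreover have "finite (U i \<inter> (\<alpha> *o U j))"
          using assms(1) by simp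
        moreover have "dim_elt emb (U i \<inter> (\<alpha> *o U j)) \<le> 1"
          using pairs j by simp
        ultimately obtain c where "t * v $ i = emb c * (s * v $ i)"
          using mem x y s t dim_elt_le_1_iff by blast
        \<comment> \<open>Cancelling the nonzero i-th coordinate of v lifts proportionality of
          single coordinates to the whole vectors.\<close>
        then have "t = emb c * s"
          using i by simp
        then have "y = emb c *s x"
          by (simp add: s t)
        then show ?thesis ..
      qed
      then show "dim_vec emb (set_product U \<inter> vec.span {v}) \<le> 1"
        by (subst dim_vec_le_1_iff[OF fin]) auto
    qed
  qed
qed

end

section \<open>Assembling the three conditions\<close>

theorem theorem3p6:
  fixes q n :: nat
    and emb :: "'k::{field, finite} \<Rightarrow> 'a::{field, finite}"
    and U :: "'r::finite \<Rightarrow> 'a set"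
    and k :: "'r \<Rightarrow> nat"
  assumes "primepow q" and "n > 0"
    and "CARD('k) = q" and "CARD('a) = q ^ n"
    and "field_embedding emb"
    and "\<And>i. subspace_elt emb (U i)"
    and "\<And>i. k i = dim_elt emb (U i)"
    and "\<And>i. k i \<ge> 2"
  defines "cond_i \<equiv>
      (\<forall>v :: 'a ^ 'r. vec.span {v} \<notin> {vec.span {axis i 1} | i. True} \<longrightarrow>
         dim_vec emb (set_product U \<inter> vec.span {v}) \<le> 1) \<and>
      (\<forall>i. dim_vec emb (set_product U \<inter> vec.span {axis i 1}) = k i \<and> k i \<ge> 2)"
    and "cond_ii \<equiv>
      (\<forall>i j. i \<noteq> j \<longrightarrow>
         (U i * set_inverse (U i)) \<inter> (U j * set_inverse (U j)) = range emb)"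
    and "cond_iii \<equiv>
      (\<forall>\<alpha> i j. i \<noteq> j \<longrightarrow> dim_elt emb (U i \<inter> (\<alpha> *o U j)) \<le> 1)"
  shows "(cond_i \<longleftrightarrow> cond_ii) \<and> (cond_ii \<longleftrightarrow> cond_iii)"
proof -
  interpret field_embedding emb
    by fact
  interpret elt: vector_space "scale_elt emb"
    by (rule vector_space_scale_elt)
  have nonzero: "\<exists>u\<in>U i. u \<noteq> 0" for i
  proof (rule ccontr)
    assume "\<not> ?thesis"
    \<comment> \<open>A subset of {0} is spanned by the empty set, so its dimension is 0, against k
      i \<ge> 2.\<close>
    then have "dim_elt emb (U i) \<le> card ({} :: 'a set)"
      by (intro elt.dim_le_card) auto
    with assms(7)[of i] assms(8)[of i] show False
      by simp
  qed
  \<comment> \<open>Clause (b) holds automatically by the axis computation, so (i) reduces to clause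
    (a).\<close>
  have "cond_i \<longleftrightarrow> cond_iii"
    using dim_off_axes_le_1_iff[of U] dim_vec_set_product_Int_span_axis[of U] assms(6-8)
    unfolding cond_i_def cond_iii_def by simp
  moreover have "U i * set_inverse (U i) \<inter> (U j * set_inverse (U j)) = range emb \<longleftrightarrow>
      (\<forall>\<alpha>. dim_elt emb (U i \<inter> (\<alpha> *o U j)) \<le> 1)" for i j
    by (rule quotients_Int_iff_dim_le_1) (simp_all add: assms(6) nonzero)
  \<comment> \<open>After rewriting pair by pair, the two sides differ only in the position of the
    quantifier over \<alpha>.\<close>
  then have "cond_ii \<longleftrightarrow> cond_iii"
    unfolding cond_ii_def cond_iii_def by (simp only:) iprover
  ultimately show ?thesis
    by blast
qed

end
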